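(* Let $R$ be an EPRF-TRS over a ranked alphabet $\Sigma$ and let $p,q\in T_\Sigma(X)$. Then it is decidable whether there exists a term $r\in T_\Sigma(X)$ such that $p\Rightarrow^*_R r$ and $q\Rightarrow^*_R r$.
   Context: A ranked alphabet $\Sigma$ is a finite set of symbols with ranks; $X=\{x_1,x_2,\dots\}$ is a countable set of variables, $T_\Sigma(X)$ the terms over $\Sigma$ and $X$, $T_\Sigma$ the ground terms. A TRS $R$ over $\Sigma$ is a finite set of rules $l\to r$, $l,r\in T_\Sigma(X)$, with every variable of $r$ occurring in $l$; $\Rightarrow_R$ is the rewrite relation, $\Rightarrow^*_R$ its reflexive transitive closure; $sign(R)$ is the set of symbols occurring in the rules. For $L\subseteq T_\Sigma$, $R^*_\Sigma(L)=\{p\mid q\Rightarrow^*_R p,\ q\in L\}$. A bottom-up tree automaton (bta) over $\Sigma$ is a finite automaton with states $A$ (treated as constants), final states $A_f$, rules $\delta(a_1,\dots,a_n)\to a$ and $a\to a'$; it recognizes the ground terms rewriting to a final state. $R$ is an EPRF-TRS if for any given ranked alphabet $\Sigma\supseteq sign(R)$ and finite $L\subseteq T_\Sigma$ one can effectively construct a bta $\mathcal{C}$ over $\Sigma$ with $L(\mathcal{C})=R^*_\Sigma(L)$. *)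

theory Defs
  imports Main "HOL-Library.Nat_Bijection"
begin

section \<open>Terms and term rewriting\<close>

datatype (funs: 'f, vars: 'v) trm = Var 'v | Fun 'f "('f, 'v) trm list"
  for map: map_trm

text \<open>A ranked alphabet is given by its pairs (symbol, rank). Symbol names are drawn from the
  natural numbers, so that alphabets can be inputs of algorithms and fresh symbols are always
  available.\<close>

type_synonym 'f ranked = "('f \<times> nat) set"

definition ranked_alphabet :: "'f ranked \<Rightarrow> bool" where
  "ranked_alphabet \<Sigma> \<longleftrightarrow> finite \<Sigma> \<and> single_valued \<Sigma>"

inductive_set terms :: "'f ranked \<Rightarrow> ('f, 'v) trm set" for \<Sigma> :: "'f ranked" where
  Var: "Var x \<in> terms \<Sigma>"
| Fun: "(f, length ts) \<in> \<Sigma> \<Longrightarrow> \<forall>t\<in>set ts. t \<in> terms \<Sigma> \<Longrightarrow> Fun f ts \<in> terms \<Sigma>"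

definition ground_terms :: "'f ranked \<Rightarrow> ('f, 'v) trm set" where
  "ground_terms \<Sigma> = {t \<in> terms \<Sigma>. vars t = {}}"

primrec subst :: "('v \<Rightarrow> ('f, 'v) trm) \<Rightarrow> ('f, 'v) trm \<Rightarrow> ('f, 'v) trm" where
  "subst \<sigma> (Var x) = \<sigma> x"
| "subst \<sigma> (Fun f ts) = Fun f (map (subst \<sigma>) ts)"

type_synonym ('f, 'v) rules = "(('f, 'v) trm \<times> ('f, 'v) trm) set"

inductive_set rstep :: "('f, 'v) rules \<Rightarrow> (('f, 'v) trm \<times> ('f, 'v) trm) set"
  for R :: "('f, 'v) rules" where
  root: "(l, r) \<in> R \<Longrightarrow> (subst \<sigma> l, subst \<sigma> r) \<in> rstep R"
| arg: "(s, t) \<in> rstep R \<Longrightarrow> (Fun f (us @ s # vs), Fun f (us @ t # vs)) \<in> rstep R"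

definition trs_over :: "'f ranked \<Rightarrow> ('f, 'v) rules \<Rightarrow> bool" where
  "trs_over \<Sigma> R \<longleftrightarrow> finite R \<and> R \<subseteq> terms \<Sigma> \<times> terms \<Sigma> \<and> (\<forall>(l, r)\<in>R. vars r \<subseteq> vars l)"

primrec symbols :: "('f, 'v) trm \<Rightarrow> 'f ranked" where
  "symbols (Var x) = {}"
| "symbols (Fun f ts) = insert (f, length ts) (\<Union>(set (map symbols ts)))"

definition sign :: "('f, 'v) rules \<Rightarrow> 'f ranked" where
  "sign R = (\<Union>(l, r)\<in>R. symbols l \<union> symbols r)"

definition descendants :: "('f, 'v) rules \<Rightarrow> ('f, 'v) trm set \<Rightarrow> ('f, 'v) trm set" where
  "descendants R L = {p. \<exists>q\<in>L. (q, p) \<in> (rstep R)\<^sup>*}"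


section \<open>Bottom-up tree automata\<close>

text \<open>A transition \<open>(d, [a\<^sub>1, \<dots>, a\<^sub>n], a)\<close> is the rule \<open>d(a\<^sub>1, \<dots>, a\<^sub>n) \<rightarrow> a\<close>, and a pair
  \<open>(a, a')\<close> in \<open>epsilons\<close> is the rule \<open>a \<rightarrow> a'\<close>.\<close>

record bta =
  states :: "nat set"
  finals :: "nat set"
  transitions :: "(nat \<times> nat list \<times> nat) set"
  epsilons :: "(nat \<times> nat) set"

definition bta_over :: "nat ranked \<Rightarrow> bta \<Rightarrow> bool" where
  "bta_over \<Sigma> C \<longleftrightarrow>
     finite (states C) \<and> finals C \<subseteq> states C \<and>
     finite (transitions C) \<and>
     (\<forall>(d, as, a)\<in>transitions C. (d, length as) \<in> \<Sigma> \<and> set as \<subseteq> states C \<and> a \<in> states C) \<and>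
     epsilons C \<subseteq> states C \<times> states C"

text \<open>An automaton works by rewriting terms over the disjoint union of the alphabet (\<open>Inl\<close>)
  and its states, the latter viewed as constants (\<open>Inr\<close>).\<close>

definition state_const :: "nat \<Rightarrow> (nat + nat, 'v) trm" where
  "state_const a = Fun (Inr a) []"

definition bta_rules :: "bta \<Rightarrow> (nat + nat, 'v) rules" where
  "bta_rules C =
     {(Fun (Inl d) (map state_const as), state_const a) | d as a. (d, as, a) \<in> transitions C} \<union>
     {(state_const a, state_const a') | a a'. (a, a') \<in> epsilons C}"

definition bta_lang :: "nat ranked \<Rightarrow> bta \<Rightarrow> (nat, 'v) trm set" where
  "bta_lang \<Sigma> C =
     {t \<in> ground_terms \<Sigma>. \<exists>a\<in>finals C. (map_trm Inl id t, state_const a) \<in> (rstep (bta_rules C))\<^sup>*}"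


section \<open>Computability\<close>

text \<open>Kleene's total recursive functions: minimization is only applied to regular functions.
  \<open>recursive n f\<close> is meaningful for the values of \<open>f\<close> on lists of length \<open>n\<close>.\<close>

inductive recursive :: "nat \<Rightarrow> (nat list \<Rightarrow> nat) \<Rightarrow> bool" where
  zero: "recursive n (\<lambda>xs. 0)"
| succ: "recursive 1 (\<lambda>xs. Suc (hd xs))"
| proj: "i < n \<Longrightarrow> recursive n (\<lambda>xs. xs ! i)"
| comp: "recursive (length fs) g \<Longrightarrow> \<forall>f\<in>set fs. recursive n f \<Longrightarrow>
    recursive n (\<lambda>xs. g (map (\<lambda>f. f xs) fs))"
| prim_rec: "recursive n g \<Longrightarrow> recursive (n + 2) h \<Longrightarrow>
    recursive (n + 1) (\<lambda>xs. rec_nat (g (tl xs)) (\<lambda>k y. h (k # y # tl xs)) (hd xs))"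
| minimize: "recursive (n + 1) f \<Longrightarrow> \<forall>xs. length xs = n \<longrightarrow> (\<exists>y. f (y # xs) = 0) \<Longrightarrow>
    recursive n (\<lambda>xs. LEAST y. f (y # xs) = 0)"

definition computable :: "(nat \<Rightarrow> nat) \<Rightarrow> bool" where
  "computable f \<longleftrightarrow> (\<exists>g. recursive 1 g \<and> (\<forall>x. f x = g [x]))"

text \<open>\<open>decidable_on D enc P\<close>: some algorithm decides \<open>P x\<close> for the inputs \<open>x \<in> D\<close>, which are
  presented by their codes \<open>enc x\<close>.\<close>

definition decidable_on :: "'a set \<Rightarrow> ('a \<Rightarrow> nat) \<Rightarrow> ('a \<Rightarrow> bool) \<Rightarrow> bool" where
  "decidable_on D enc P \<longleftrightarrow>
     (\<exists>f. computable f \<and> (\<forall>x\<in>D. f (enc x) = (if P x then 1 else 0)))"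


section \<open>Encodings\<close>

primrec enc_trm :: "(nat, nat) trm \<Rightarrow> nat" where
  "enc_trm (Var x) = sum_encode (Inl x)"
| "enc_trm (Fun f ts) = sum_encode (Inr (prod_encode (f, list_encode (map enc_trm ts))))"

definition enc_trm_pair :: "(nat, nat) trm \<times> (nat, nat) trm \<Rightarrow> nat" where
  "enc_trm_pair = (\<lambda>(p, q). prod_encode (enc_trm p, enc_trm q))"

text \<open>\<open>set_encode\<close> is injective on finite sets, the only ones that are encoded below.\<close>

definition enc_alphabet :: "nat ranked \<Rightarrow> nat" where
  "enc_alphabet \<Sigma> = set_encode (prod_encode ` \<Sigma>)"

definition enc_trm_set :: "(nat, nat) trm set \<Rightarrow> nat" where
  "enc_trm_set L = set_encode (enc_trm ` L)"

definition enc_transition :: "nat \<times> nat list \<times> nat \<Rightarrow> nat" where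
  "enc_transition = (\<lambda>(d, as, a). prod_encode (d, prod_encode (list_encode as, a)))"

definition enc_bta :: "bta \<Rightarrow> nat" where
  "enc_bta C = list_encode
     [set_encode (states C), set_encode (finals C),
      set_encode (enc_transition ` transitions C), set_encode (prod_encode ` epsilons C)]"

lemma enc_trm_inject: "enc_trm s = enc_trm t \<longleftrightarrow> s = t"
proof
  show "enc_trm s = enc_trm t \<Longrightarrow> s = t"
  proof (induction s arbitrary: t)
    case (Var x)
    then show ?case by (cases t) (auto simp: sum_encode_eq)
  next
    case (Fun f ts)
    then obtain us where t: "t = Fun f us" and "map enc_trm ts = map enc_trm us"
      by (cases t) (auto simp: sum_encode_eq list_encode_eq)
    with Fun.IH have "ts = us"
      by (metis (no_types, lifting) in_set_conv_nth length_map nth_equalityI nth_map)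
    with t show ?case by simp
  qed
qed simp

lemma enc_bta_inject:
  assumes "bta_over \<Sigma> C" "bta_over \<Sigma>' C'" "enc_bta C = enc_bta C'"
  shows "C = C'"
proof -
  have fin: "finite (states B)" "finite (finals B)" "finite (transitions B)" "finite (epsilons B)"
    if "bta_over S B" for S B
    using that unfolding bta_over_def
    by (auto intro: finite_subset[of _ "states B"] finite_subset[of _ "states B \<times> states B"])
  have inj: "inj enc_transition"
    by (auto simp: inj_def enc_transition_def list_encode_eq)
  have "enc_transition ` transitions C = enc_transition ` transitions C'"
    "prod_encode ` epsilons C = prod_encode ` epsilons C'"
    "states C = states C'" "finals C = finals C'"
    using assms(3) fin[OF assms(1)] fin[OF assms(2)]
    by (simp_all add: enc_bta_def set_encode_eq)
  then show ?thesis
    using inj inj_prod_encode[of UNIV] by (simp add: inj_image_eq_iff)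
qed


section \<open>Effective preservation of recognizability on finite languages\<close>

text \<open>The algorithm may depend on \<open>R\<close>; its input is the pair \<open>(\<Sigma>, L)\<close>. Since valid inputs form
  a decidable set, it is no restriction to take a total function with arbitrary values on invalid
  inputs.\<close>

definition eprf :: "(nat, nat) rules \<Rightarrow> bool" where
  "eprf R \<longleftrightarrow>
     (\<exists>F. computable F \<and>
        (\<forall>\<Sigma> L. ranked_alphabet \<Sigma> \<and> sign R \<subseteq> \<Sigma> \<and> finite L \<and> L \<subseteq> ground_terms \<Sigma> \<longrightarrow>
           (\<exists>C. bta_over \<Sigma> C \<and> F (prod_encode (enc_alphabet \<Sigma>, enc_trm_set L)) = enc_bta C \<and>
                bta_lang \<Sigma> C = descendants R L)))"

end

theory Submission
  imports Defs
begin

text \<open>Choose fresh symbols \<open>s\<close> (unary) and \<open>c\<close> (constant). Replacing every variable \<open>x\<^sub>i\<close> by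
  \<open>s(\<dots>s(c)\<dots>)\<close> with \<open>i\<close> occurrences of \<open>s\<close> turns joinability of \<open>p\<close> and \<open>q\<close> into joinability of two
  ground terms over one alphabet that does not depend on \<open>p\<close> and \<open>q\<close>. The sets of descendants of
  these terms are recognized by computable automata, so it remains to decide whether two
  automata have a common term. They have none iff some set of pairs of states is closed under the
  transitions of the product automaton and contains no pair of final states; these finitely many
  candidates are tested one after the other.\<close>


section \<open>Recursive functions\<close>

text \<open>\<open>recursive n f\<close> determines \<open>f\<close> on lists of every length,
  whereas only lists of length \<open>n\<close> carry meaning. Closing under agreement on these
  lists lets functions be written in any convenient form.\<close>

definition recursive_fun :: "nat \<Rightarrow> (nat list \<Rightarrow> nat) \<Rightarrow> bool" where
  "recursive_fun n f \<longleftrightarrow> (\<exists>g. recursive n g \<and> (\<forall>xs. length xs = n \<longrightarrow> f xs = g xs))"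

lemma recursive_funI:
  assumes "recursive n g" "\<And>xs. length xs = n \<Longrightarrow> f xs = g xs"
  shows "recursive_fun n f"
  using assms unfolding recursive_fun_def by blast

lemma recursive_fun_cong:
  assumes "recursive_fun n g" "\<And>xs. length xs = n \<Longrightarrow> f xs = g xs"
  shows "recursive_fun n f"
  using assms unfolding recursive_fun_def by auto

lemma recursive_fun_proj: "i < n \<Longrightarrow> recursive_fun n (\<lambda>xs. xs ! i)"
  by (rule recursive_funI[OF recursive.proj]) auto

lemma recursive_fun_comp:
  assumes "recursive_fun (length fs) g" "\<forall>f\<in>set fs. recursive_fun n f"
  shows "recursive_fun n (\<lambda>xs. g (map (\<lambda>f. f xs) fs))"
proof -
  obtain g' where g: "recursive (length fs) g'" "\<And>xs. length xs = length fs \<Longrightarrow> g xs = g' xs"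
    using assms(1) unfolding recursive_fun_def by blast
  obtain F where F: "\<forall>f\<in>set fs. recursive n (F f) \<and> (\<forall>xs. length xs = n \<longrightarrow> f xs = F f xs)"
    using bchoice[OF assms(2)[unfolded recursive_fun_def]] by blast
  have *: "recursive n (\<lambda>xs. g' (map (\<lambda>f. f xs) (map F fs)))"
    by (rule recursive.comp) (use g(1) F in auto)
  show ?thesis
  proof (rule recursive_funI[OF *])
    fix xs :: "nat list" assume "length xs = n"
    then have *: "map (\<lambda>f. f xs) (map F fs) = map (\<lambda>f. f xs) fs"
      using F by simp
    show "g (map (\<lambda>f. f xs) fs) = g' (map (\<lambda>f. f xs) (map F fs))"
      unfolding * by (rule g(2)) simp
  qed
qed

lemma recursive_fun_comp1:
  assumes "recursive_fun 1 (\<lambda>xs. g (xs ! 0))" "recursive_fun n a"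
  shows "recursive_fun n (\<lambda>xs. g (a xs))"
  using recursive_fun_comp[of "[a]" "\<lambda>xs. g (xs ! 0)" n] assms by simp

lemma recursive_fun_comp2:
  assumes "recursive_fun 2 (\<lambda>xs. g (xs ! 0) (xs ! 1))" "recursive_fun n a" "recursive_fun n b"
  shows "recursive_fun n (\<lambda>xs. g (a xs) (b xs))"
  using recursive_fun_comp[of "[a, b]" "\<lambda>xs. g (xs ! 0) (xs ! 1)" n] assms
  by (simp add: numeral_2_eq_2)

lemma recursive_fun_prim_rec:
  assumes "recursive_fun n g" "recursive_fun (n + 2) h"
  shows "recursive_fun (n + 1) (\<lambda>xs. rec_nat (g (tl xs)) (\<lambda>k y. h (k # y # tl xs)) (hd xs))"
proof -
  obtain g' h' where *: "recursive n g'" "\<And>xs. length xs = n \<Longrightarrow> g xs = g' xs"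
    "recursive (n + 2) h'" "\<And>xs. length xs = n + 2 \<Longrightarrow> h xs = h' xs"
    using assms unfolding recursive_fun_def by blast
  show ?thesis
    by (rule recursive_funI[OF recursive.prim_rec[OF *(1,3)]]) (simp add: *(2,4))
qed

lemma recursive_fun_minimize:
  assumes "recursive_fun (n + 1) f" "\<And>xs. length xs = n \<Longrightarrow> \<exists>y. f (y # xs) = 0"
  shows "recursive_fun n (\<lambda>xs. LEAST y. f (y # xs) = 0)"
proof -
  obtain f' where f': "recursive (n + 1) f'" "\<And>xs. length xs = n + 1 \<Longrightarrow> f xs = f' xs"
    using assms(1) unfolding recursive_fun_def by blast
  have "recursive n (\<lambda>xs. LEAST y. f' (y # xs) = 0)"
    by (rule recursive.minimize[OF f'(1)]) (use assms(2) f'(2) in auto)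
  then show ?thesis
    by (rule recursive_funI) (simp add: f'(2))
qed

lemma recursive_fun_Suc: "recursive_fun n a \<Longrightarrow> recursive_fun n (\<lambda>xs. Suc (a xs))"
  by (rule recursive_fun_comp1, rule recursive_funI[OF recursive.succ])
    (auto simp: length_Suc_conv)

lemma recursive_fun_const: "recursive_fun n (\<lambda>xs. c)"
  by (induction c) (auto intro: recursive_fun_Suc recursive_funI[OF recursive.zero])

lemma recursive_fun_rec_nat_1:
  assumes "recursive_fun 2 (\<lambda>xs. h (xs ! 0) (xs ! 1))"
  shows "recursive_fun 1 (\<lambda>xs. rec_nat c h (xs ! 0))"
proof -
  have "recursive_fun (0 + 1)
      (\<lambda>xs. rec_nat c (\<lambda>k y. h ((k # y # tl xs) ! 0) ((k # y # tl xs) ! 1)) (hd xs))"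
    by (rule recursive_fun_prim_rec)
      (use assms in \<open>simp_all add: recursive_fun_const numeral_2_eq_2\<close>)
  then show ?thesis
    unfolding add_0 by (rule recursive_fun_cong) (auto simp: length_Suc_conv)
qed

lemma recursive_fun_rec_nat_2:
  assumes "recursive_fun 3 (\<lambda>xs. h (xs ! 0) (xs ! 1) (xs ! 2))"
    and "recursive_fun 1 (\<lambda>xs. g (xs ! 0))"
  shows "recursive_fun 2 (\<lambda>xs. rec_nat (g (xs ! 1)) (\<lambda>k y. h k y (xs ! 1)) (xs ! 0))"
proof -
  have "1 + 2 = (3::nat)" by simp
  from recursive_fun_prim_rec[OF assms(2), unfolded this, OF assms(1), unfolded one_add_one]
  show ?thesis
    by (rule recursive_fun_cong) (auto simp: length_Suc_conv numeral_2_eq_2)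
qed

section \<open>Addition, truncated subtraction and triangular numbers\<close>

lemma recursive_fun_add:
  "recursive_fun n a \<Longrightarrow> recursive_fun n b \<Longrightarrow> recursive_fun n (\<lambda>xs. a xs + b xs)"
proof (rule recursive_fun_comp2[where g = "(+)"])
  have *: "m + n = rec_nat n (\<lambda>k y. Suc y) m" for m n :: nat
    by (induction m) auto
  show "recursive_fun 2 (\<lambda>xs. xs ! 0 + xs ! 1)"
    unfolding * by (intro recursive_fun_rec_nat_2 recursive_fun_Suc recursive_fun_proj) simp_all
qed

lemma recursive_fun_pred: "recursive_fun n a \<Longrightarrow> recursive_fun n (\<lambda>xs. a xs - 1)"
proof (rule recursive_fun_comp1[where g = "\<lambda>m. m - 1"])
  have *: "m - 1 = rec_nat 0 (\<lambda>k y. k) m" for m :: nat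
    by (induction m) auto
  show "recursive_fun 1 (\<lambda>xs. xs ! 0 - 1)"
    unfolding * by (intro recursive_fun_rec_nat_1 recursive_fun_proj) simp
qed

lemma recursive_fun_diff:
  "recursive_fun n a \<Longrightarrow> recursive_fun n b \<Longrightarrow> recursive_fun n (\<lambda>xs. a xs - b xs)"
\<comment> \<open>Primitive recursion runs over the first argument, which here has to be the
  subtrahend; hence the exchange of arguments.\<close>
proof (rule recursive_fun_comp2[where g = "\<lambda>m n. n - m" and a = b and b = a])
  have *: "rec_nat n (\<lambda>k y. y - 1) m = n - m" for m n :: nat
    by (induction m) auto
  have "recursive_fun 2 (\<lambda>xs. rec_nat (xs ! 1) (\<lambda>k y. y - 1) (xs ! 0))"
    by (intro recursive_fun_rec_nat_2 recursive_fun_pred recursive_fun_proj) simp_all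
  then show "recursive_fun 2 (\<lambda>xs. xs ! 1 - xs ! 0)"
    unfolding * .
qed

lemma recursive_fun_triangle: "recursive_fun n a \<Longrightarrow> recursive_fun n (\<lambda>xs. triangle (a xs))"
proof (rule recursive_fun_comp1[where g = triangle])
  have *: "triangle m = rec_nat 0 (\<lambda>k y. y + Suc k) m" for m :: nat
    by (induction m) auto
  show "recursive_fun 1 (\<lambda>xs. triangle (xs ! 0))"
    unfolding *
    by (intro recursive_fun_rec_nat_1 recursive_fun_add recursive_fun_Suc recursive_fun_proj)
      simp_all
qed


section \<open>Computable functions of one argument\<close>

text \<open>Functions of several arguments are handled through the pairing function, so that every
  context of variables is a single number.\<close>

named_theorems computable_intros

definition pfst :: "nat \<Rightarrow> nat" where "pfst z = fst (prod_decode z)"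
definition psnd :: "nat \<Rightarrow> nat" where "psnd z = snd (prod_decode z)"

lemma pfst_prod_encode [simp]: "pfst (prod_encode (a, b)) = a"
  and psnd_prod_encode [simp]: "psnd (prod_encode (a, b)) = b"
  by (simp_all add: pfst_def psnd_def)

lemma prod_encode_pfst_psnd [simp]: "prod_encode (pfst z, psnd z) = z"
  by (simp add: pfst_def psnd_def)

lemma psnd_le: "psnd z \<le> z"
  by (metis prod_encode_pfst_psnd le_prod_encode_2)

lemma computable_iff: "computable f \<longleftrightarrow> recursive_fun 1 (\<lambda>xs. f (xs ! 0))"
proof
  assume "computable f"
  then show "recursive_fun 1 (\<lambda>xs. f (xs ! 0))"
    unfolding computable_def by (auto intro!: recursive_funI simp: length_Suc_conv)
next
  assume "recursive_fun 1 (\<lambda>xs. f (xs ! 0))"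
  then show "computable f"
    unfolding recursive_fun_def computable_def
    by (metis One_nat_def length_Cons list.size(3) nth_Cons_0)
qed

lemma computable_const [computable_intros]: "computable (\<lambda>x. c)"
  by (simp add: computable_iff recursive_fun_const)

lemma computable_id [computable_intros]: "computable (\<lambda>x. x)"
  by (simp add: computable_iff recursive_fun_proj)

lemma computable_comp: "computable f \<Longrightarrow> computable a \<Longrightarrow> computable (\<lambda>x. f (a x))"
  unfolding computable_iff by (rule recursive_fun_comp1)

lemma computable_add [computable_intros]:
  "computable a \<Longrightarrow> computable b \<Longrightarrow> computable (\<lambda>x. a x + b x)"
  unfolding computable_iff by (rule recursive_fun_add)

lemma computable_diff [computable_intros]:
  "computable a \<Longrightarrow> computable b \<Longrightarrow> computable (\<lambda>x. a x - b x)"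
  unfolding computable_iff by (rule recursive_fun_diff)

lemma computable_Suc [computable_intros]: "computable a \<Longrightarrow> computable (\<lambda>x. Suc (a x))"
  unfolding computable_iff by (rule recursive_fun_Suc)

section \<open>The pairing function and its projections\<close>

lemma recursive_fun_prod_encode:
  "recursive_fun n a \<Longrightarrow> recursive_fun n b \<Longrightarrow> recursive_fun n (\<lambda>xs. prod_encode (a xs, b xs))"
  unfolding prod_encode_def by (simp add: recursive_fun_add recursive_fun_triangle)

lemma computable_prod_encode [computable_intros]:
  "computable a \<Longrightarrow> computable b \<Longrightarrow> computable (\<lambda>x. prod_encode (a x, b x))"
  unfolding computable_iff by (rule recursive_fun_prod_encode)

lemma mono_triangle: "mono triangle"
  by (rule mono_iff_le_Suc[THEN iffD2]) simp

lemma prod_encode_mono: "a \<le> c \<Longrightarrow> b \<le> d \<Longrightarrow> prod_encode (a, b) \<le> prod_encode (c, d)"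
  unfolding prod_encode_def using monoD[OF mono_triangle, of "a + b" "c + d"] by simp

text \<open>\<open>prod_encode (a, b)\<close> lies on the diagonal \<open>a + b\<close>, which is recovered by a search.\<close>

lemma prod_encode_diagonal:
  "(LEAST t. Suc (prod_encode (a, b)) - triangle (Suc t) = 0) = a + b"
proof (rule Least_equality)
  show "Suc (prod_encode (a, b)) - triangle (Suc (a + b)) = 0"
    by (simp add: prod_encode_def)
  fix t assume *: "Suc (prod_encode (a, b)) - triangle (Suc t) = 0"
  show "a + b \<le> t"
  proof (rule ccontr)
    assume "\<not> a + b \<le> t"
    then have "triangle (Suc t) \<le> triangle (a + b)"
      by (intro monoD[OF mono_triangle]) simp
    with * show False
      by (simp add: prod_encode_def del: triangle_Suc)
  qed
qed

lemma computable_diagonal: "computable (\<lambda>z. pfst z + psnd z)"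
proof -
  have "recursive_fun 1
      (\<lambda>xs. LEAST t. Suc ((t # xs) ! 1) - triangle (Suc ((t # xs) ! 0)) = 0)"
  proof (rule recursive_fun_minimize)
    show "recursive_fun (1 + 1) (\<lambda>xs. Suc (xs ! 1) - triangle (Suc (xs ! 0)))"
      by (intro recursive_fun_diff recursive_fun_Suc recursive_fun_triangle recursive_fun_proj)
        auto
    fix xs :: "nat list"
    \<comment> \<open>The search is regular: \<open>t = z\<close> always succeeds, because
      \<open>triangle (Suc z)\<close> is at least \<open>Suc z\<close>.\<close>
    have "Suc ((xs ! 0 # xs) ! 1) - triangle (Suc ((xs ! 0 # xs) ! 0)) = 0"
      by simp
    then show "\<exists>t. Suc ((t # xs) ! 1) - triangle (Suc ((t # xs) ! 0)) = 0" ..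
  qed
  then show ?thesis
    unfolding computable_iff
  proof (rule recursive_fun_cong)
    fix xs :: "nat list"
    show "pfst (xs ! 0) + psnd (xs ! 0)
        = (LEAST t. Suc ((t # xs) ! 1) - triangle (Suc ((t # xs) ! 0)) = 0)"
      using prod_encode_diagonal[of "pfst (xs ! 0)" "psnd (xs ! 0)"] by simp
  qed
qed

lemma computable_pfst [computable_intros]:
  assumes "computable a" shows "computable (\<lambda>x. pfst (a x))"
proof (rule computable_comp[OF _ assms])
  have *: "pfst z = z - triangle (pfst z + psnd z)" for z
    using prod_encode_pfst_psnd[of z] unfolding prod_encode_def by simp
  have "computable (\<lambda>z. z - triangle (pfst z + psnd z))"
    using computable_diagonal computable_id
    unfolding computable_iff by (intro recursive_fun_diff recursive_fun_triangle)
  then show "computable pfst"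
    by (subst (asm) *[symmetric])
qed

lemma computable_psnd [computable_intros]:
  assumes "computable a" shows "computable (\<lambda>x. psnd (a x))"
proof (rule computable_comp[OF _ assms])
  have "computable (\<lambda>z. (pfst z + psnd z) - pfst z)"
    by (intro computable_diff computable_diagonal computable_pfst computable_id)
  then show "computable psnd"
    by simp
qed

text \<open>The step function receives counter, previous value and context packed as the nested pair
  \<open>(k, (y, x))\<close>, so that it is again a function of one number.\<close>

lemma computable_rec_nat:
  assumes "computable (\<lambda>z. h (pfst z) (pfst (psnd z)) (psnd (psnd z)))"
    and "computable g" and "computable b"
  shows "computable (\<lambda>x. rec_nat (g x) (\<lambda>k y. h k y x) (b x))"
proof -
  have "recursive_fun 3 (\<lambda>xs. h (xs ! 0) (xs ! 1) (xs ! 2))"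
  proof -
    have "recursive_fun 3 (\<lambda>xs. prod_encode (xs ! 0, prod_encode (xs ! 1, xs ! 2)))"
      by (intro recursive_fun_prod_encode recursive_fun_proj) auto
    from recursive_fun_comp1[OF assms(1)[unfolded computable_iff] this] show ?thesis
      by simp
  qed
  from recursive_fun_rec_nat_2[OF this assms(2)[unfolded computable_iff]]
  have "recursive_fun 2 (\<lambda>xs. rec_nat (g (xs ! 1)) (\<lambda>k y. h k y (xs ! 1)) (xs ! 0))" .
  from recursive_fun_comp2[OF this, of 1 "\<lambda>xs. b (xs ! 0)" "\<lambda>xs. xs ! 0"] show ?thesis
    using assms(3) by (simp add: computable_iff recursive_fun_proj)
qed

section \<open>Multiplication and binary arithmetic\<close>

lemma computable_mult [computable_intros]:
  assumes "computable a" "computable b" shows "computable (\<lambda>x. a x * b x)"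
proof -
  have *: "m * n = rec_nat 0 (\<lambda>k y. y + n) m" for m n :: nat
    by (induction m) auto
  have "computable (\<lambda>z. pfst z * psnd z)"
    unfolding * by (intro computable_rec_nat computable_intros)
  from computable_comp[OF this computable_prod_encode[OF assms]] show ?thesis
    by simp
qed

lemma computable_power_2 [computable_intros]:
  assumes "computable a" shows "computable (\<lambda>x. 2 ^ a x)"
proof -
  have *: "2 ^ n = rec_nat (1::nat) (\<lambda>k y. y + y) n" for n
    by (induction n) auto
  show ?thesis
    unfolding * by (intro computable_rec_nat computable_intros assms)
qed

lemma computable_mod_2 [computable_intros]:
  assumes "computable a" shows "computable (\<lambda>x. a x mod 2)"
proof -
  have *: "n mod 2 = rec_nat 0 (\<lambda>k y. 1 - y) n" for n :: nat
    by (induction n) (auto simp: mod_Suc)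
  show ?thesis
    unfolding * by (intro computable_rec_nat computable_intros assms)
qed

lemma computable_div_2 [computable_intros]:
  assumes "computable a" shows "computable (\<lambda>x. a x div 2)"
proof -
  \<comment> \<open>The quotient grows exactly in passing from an odd \<open>k\<close> to
    \<open>Suc k\<close>.\<close>
  have *: "n div 2 = rec_nat 0 (\<lambda>k y. y + k mod 2) n" for n :: nat
    by (induction n) (auto, presburger)
  show ?thesis
    unfolding * by (intro computable_rec_nat computable_intros assms)
qed

lemma computable_div_power_2 [computable_intros]:
  assumes "computable a" "computable b" shows "computable (\<lambda>x. a x div 2 ^ b x)"
proof -
  have *: "m div 2 ^ n = rec_nat m (\<lambda>k y. y div 2) n" for m n :: nat
    by (induction n) (simp_all add: div_mult2_eq power_Suc2 del: power_Suc)
  show ?thesis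
    unfolding * by (intro computable_rec_nat computable_intros assms)
qed


section \<open>Decidable predicates\<close>

definition decidable :: "(nat \<Rightarrow> bool) \<Rightarrow> bool" where
  "decidable P \<longleftrightarrow> computable (\<lambda>x. of_bool (P x))"

lemma decidable_comp: "decidable P \<Longrightarrow> computable a \<Longrightarrow> decidable (\<lambda>x. P (a x))"
  unfolding decidable_def by (rule computable_comp)

lemma decidable_eq [computable_intros]:
  assumes "computable a" "computable b" shows "decidable (\<lambda>x. a x = b x)"
proof -
  have *: "of_bool (m = n) = 1 - ((m - n) + (n - m))" for m n :: nat
    by auto
  show ?thesis
    unfolding decidable_def * by (intro computable_intros assms)
qed

lemma decidable_not [computable_intros]:
  assumes "decidable P" shows "decidable (\<lambda>x. \<not> P x)"
proof -
  have *: "of_bool (\<not> p) = 1 - (of_bool p :: nat)" for p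
    by auto
  show ?thesis
    unfolding decidable_def * by (intro computable_intros assms[unfolded decidable_def])
qed

lemma decidable_conj [computable_intros]:
  assumes "decidable P" "decidable Q" shows "decidable (\<lambda>x. P x \<and> Q x)"
  using assms unfolding decidable_def of_bool_conj by (rule computable_mult)

lemma decidable_imp [computable_intros]:
  assumes "decidable P" "decidable Q" shows "decidable (\<lambda>x. P x \<longrightarrow> Q x)"
proof -
  have "decidable (\<lambda>x. \<not> (P x \<and> \<not> Q x))"
    by (intro computable_intros assms)
  then show ?thesis
    by simp
qed

lemma decidable_iff [computable_intros]:
  assumes "decidable P" "decidable Q" shows "decidable (\<lambda>x. P x \<longleftrightarrow> Q x)"
proof -
  have "decidable (\<lambda>x. (P x \<longrightarrow> Q x) \<and> (Q x \<longrightarrow> P x))"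
    by (intro computable_intros assms)
  then show ?thesis
    by (simp add: iff_conv_conj_imp)
qed

text \<open>A bounded universal quantifier is a product of truth values, which a primitive recursion
  accumulates.\<close>

lemma decidable_all_less [computable_intros]:
  assumes "decidable (\<lambda>z. P (pfst z) (psnd z))" "computable b"
  shows "decidable (\<lambda>x. \<forall>y<b x. P y x)"
proof -
  have *: "rec_nat (1::nat) (\<lambda>k y. y * of_bool (P k x)) n = of_bool (\<forall>y<n. P y x)" for n x
    by (induction n) (auto simp: All_less_Suc)
  have "computable (\<lambda>z. of_bool (P (pfst z) (psnd (psnd z))))"
  proof -
    have "computable (\<lambda>z. prod_encode (pfst z, psnd (psnd z)))"
      by (intro computable_intros)
    from computable_comp[OF assms(1)[unfolded decidable_def] this] show ?thesis
      by simp
  qed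
  then show ?thesis
    unfolding decidable_def *[symmetric]
    by (intro computable_rec_nat assms(2) computable_intros)
qed

lemma decidable_set_decode [computable_intros]:
  assumes "computable a" "computable b" shows "decidable (\<lambda>x. a x \<in> set_decode (b x))"
proof -
  have *: "m \<in> set_decode n \<longleftrightarrow> \<not> n div 2 ^ m mod 2 = 0" for m n
    by (simp add: set_decode_def odd_iff_mod_2_eq_one)
  show ?thesis
    unfolding * by (intro computable_intros assms)
qed

lemma computable_if [computable_intros]:
  assumes "decidable P" "computable a" "computable b"
  shows "computable (\<lambda>x. if P x then a x else b x)"
proof -
  have *: "(if p then m else n) = of_bool p * m + (1 - of_bool p) * n" for p and m n :: nat
    by auto
  show ?thesis
    unfolding * by (intro computable_intros assms assms(1)[unfolded decidable_def])
qed


section \<open>Coded lists\<close>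

text \<open>\<open>list_encode\<close> codes the empty list by 0 and a nonempty list by the
  successor of a pair, whence the subtraction of 1. As \<open>ltl\<close> maps 0 to 0, dropping
  beyond the end yields the empty list.\<close>

definition lhd :: "nat \<Rightarrow> nat" where "lhd l = pfst (l - 1)"
definition ltl :: "nat \<Rightarrow> nat" where "ltl l = psnd (l - 1)"
definition ldrop :: "nat \<Rightarrow> nat \<Rightarrow> nat" where "ldrop i l = rec_nat l (\<lambda>k y. ltl y) i"

lemma lhd_list_encode [simp]: "lhd (list_encode (x # xs)) = x"
  by (simp add: lhd_def)

lemma ltl_list_encode [simp]: "ltl (list_encode xs) = list_encode (tl xs)"
proof (cases xs)
  case Nil
  then show ?thesis
    using psnd_le[of 0] by (simp add: ltl_def)
qed (simp add: ltl_def)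

lemma ldrop_list_encode [simp]: "ldrop i (list_encode xs) = list_encode (drop i xs)"
proof -
  have "rec_nat (list_encode xs) (\<lambda>k y. ltl y) i = list_encode (drop i xs)"
    by (induction i) (simp_all add: tl_drop drop_Suc)
  then show ?thesis
    by (simp add: ldrop_def)
qed

lemma lhd_list_encode_drop [simp]: "i < length xs \<Longrightarrow> lhd (list_encode (drop i xs)) = xs ! i"
  by (metis Cons_nth_drop_Suc lhd_list_encode)

lemma list_encode_eq_0 [simp]: "list_encode xs = 0 \<longleftrightarrow> xs = []"
  by (cases xs) auto

lemma length_le_list_encode: "length xs \<le> list_encode xs"
proof (induction xs)
  case (Cons x xs)
  then show ?case
    using le_prod_encode_2[of "list_encode xs" x] by simp
qed simp

lemma computable_lhd [computable_intros]: "computable a \<Longrightarrow> computable (\<lambda>x. lhd (a x))"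
  unfolding lhd_def by (intro computable_intros)

lemma computable_ltl [computable_intros]: "computable a \<Longrightarrow> computable (\<lambda>x. ltl (a x))"
  unfolding ltl_def by (intro computable_intros)

lemma computable_ldrop [computable_intros]:
  "computable a \<Longrightarrow> computable b \<Longrightarrow> computable (\<lambda>x. ldrop (a x) (b x))"
  unfolding ldrop_def by (intro computable_rec_nat computable_intros)

text \<open>A primitive recursion carries the coded table of all earlier values. Each new value is
  put in front, so the table lists the values in descending order of their arguments.\<close>

lemma course_of_values_recursion:
  assumes "computable (\<lambda>z. h (pfst z) (psnd z))"
  obtains f where "computable f" "\<And>n. f n = h n (list_encode (map f (rev [0..<n])))"
proof
  define tab where "tab n = rec_nat 0 (\<lambda>k y. Suc (prod_encode (h k y, y))) n" for n
  define f where "f n = h n (tab n)" for n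
  have "computable (\<lambda>z. h (pfst z) (pfst (psnd z)))"
    using computable_comp[OF assms, of "\<lambda>z. prod_encode (pfst z, pfst (psnd z))"]
    by (simp add: computable_intros)
  then have "computable tab"
    unfolding tab_def by (intro computable_rec_nat computable_intros)
  then have "computable (\<lambda>n. prod_encode (n, tab n))"
    by (intro computable_intros)
  from computable_comp[OF assms this] show "computable f"
    by (simp add: f_def[abs_def])
  have "tab n = list_encode (map f (rev [0..<n]))" for n
    by (induction n) (simp_all add: tab_def f_def)
  then show "f n = h n (list_encode (map f (rev [0..<n])))" for n
    by (simp add: f_def)
qed


section \<open>Substitution on codes of terms\<close>

text \<open>The argument list of a term has a smaller code than the term, and head and tail of a
  list have smaller codes than the list. Substitution is therefore a course-of-values recursion on
  codes.\<close>

lemma computable_subst: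
  assumes "computable (\<lambda>i. enc_trm (\<tau> i))"
  obtains g where "computable g" "\<And>t. g (enc_trm t) = enc_trm (subst \<tau> t)"
proof -
  \<comment> \<open>The first component of \<open>f n\<close> is the value for \<open>n\<close> read as the code of a term, the second one
    the value for \<open>n\<close> read as the code of a list of codes of terms.\<close>
  define lk where "lk n T j = lhd (ldrop (n - Suc j) T)" for n T j :: nat
  define h where "h n T = prod_encode (
      if n mod 2 = 0 then enc_trm (\<tau> (n div 2))
      else Suc (2 * prod_encode (pfst (n div 2), psnd (lk n T (psnd (n div 2))))),
      if n = 0 then 0
      else Suc (prod_encode (pfst (lk n T (pfst (n - 1))), psnd (lk n T (psnd (n - 1))))))" for n T
  have "computable (\<lambda>z. h (pfst z) (psnd z))"
    unfolding h_def lk_def by (intro computable_intros computable_comp[OF assms])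
  then obtain f where "computable f" and f': "\<And>n. f n = h n (list_encode (map f (rev [0..<n])))"
    by (rule course_of_values_recursion) blast
  \<comment> \<open>The newest entry comes first, so the value for \<open>j\<close> stands at
    position \<open>n - Suc j\<close>.\<close>
  have lk: "lk n (list_encode (map f (rev [0..<n]))) j = f j" if "j < n" for n j
    using that by (simp add: lk_def rev_nth del: rev_map flip: rev_map)
  \<comment> \<open>\<open>sum_encode\<close> gives even codes to variables and odd codes to
    applications; this is the parity test in \<open>h\<close>.\<close>
  have f_Var: "pfst (f (2 * i)) = enc_trm (\<tau> i)" for i
    by (subst f') (simp add: h_def)
  have f_Fun: "pfst (f (Suc (2 * prod_encode (d, l)))) = Suc (2 * prod_encode (d, psnd (f l)))"
    for d l
  proof -
    have "l < Suc (2 * prod_encode (d, l))"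
      using le_prod_encode_2[of l d] by simp
    from lk[OF this] show ?thesis
      by (subst f') (simp add: h_def)
  qed
  have f_Nil: "psnd (f 0) = 0"
    by (subst f') (simp add: h_def)
  have f_Cons: "psnd (f (Suc (prod_encode (a, l)))) = Suc (prod_encode (pfst (f a), psnd (f l)))"
    for a l
  proof -
    have "a < Suc (prod_encode (a, l))" "l < Suc (prod_encode (a, l))"
      using le_prod_encode_1[of a l] le_prod_encode_2[of l a] by simp_all
    from this[THEN lk] show ?thesis
      by (subst f') (simp add: h_def)
  qed
  show ?thesis
  proof
    show "computable (\<lambda>x. pfst (f x))"
      by (intro computable_pfst \<open>computable f\<close>)
    show "pfst (f (enc_trm t)) = enc_trm (subst \<tau> t)" for t
    proof (induction t)
      case (Fun d ts)
      then have "psnd (f (list_encode (map enc_trm ts)))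
          = list_encode (map (\<lambda>t. enc_trm (subst \<tau> t)) ts)"
        by (induction ts) (simp_all add: f_Nil f_Cons)
      then show ?case
        by (simp add: sum_encode_def f_Fun comp_def)
    qed (simp add: sum_encode_def f_Var)
  qed
qed


section \<open>Replacing variables by ground terms over a fixed alphabet\<close>

lemma subst_subst: "subst \<tau> (subst \<sigma> t) = subst (\<lambda>x. subst \<tau> (\<sigma> x)) t"
  by (induction t) auto

lemma subst_Var: "subst Var t = t"
  by (induction t) (auto intro: map_idI)

lemma rstep_subst: "(s, t) \<in> rstep R \<Longrightarrow> (subst \<tau> s, subst \<tau> t) \<in> rstep R"
  by (induction rule: rstep.induct) (auto simp: subst_subst intro: rstep.intros)

lemma rsteps_subst: "(s, t) \<in> (rstep R)\<^sup>* \<Longrightarrow> (subst \<tau> s, subst \<tau> t) \<in> (rstep R)\<^sup>*"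
  by (induction rule: rtrancl_induct) (auto intro: rtrancl.rtrancl_into_rtrancl rstep_subst)

lemma rsteps_arg:
  assumes "(s, t) \<in> (rstep R)\<^sup>*"
  shows "(Fun f (us @ s # vs), Fun f (us @ t # vs)) \<in> (rstep R)\<^sup>*"
  using assms
  by (induction rule: rtrancl_induct) (auto intro: rtrancl.rtrancl_into_rtrancl rstep.arg)

lemma subst_in_terms:
  assumes "t \<in> terms \<Sigma>" "\<And>x. x \<in> vars t \<Longrightarrow> \<sigma> x \<in> terms \<Sigma>"
  shows "subst \<sigma> t \<in> terms \<Sigma>"
  using assms
proof (induction t rule: terms.induct)
  case (Fun f ts)
  then have "\<forall>t\<in>set ts. subst \<sigma> t \<in> terms \<Sigma>"
    by force
  with Fun(1) show ?case
    by (auto intro!: terms.Fun)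
qed simp

lemma subst_in_termsD: "subst \<sigma> t \<in> terms \<Sigma> \<Longrightarrow> x \<in> vars t \<Longrightarrow> \<sigma> x \<in> terms \<Sigma>"
  by (induction t) (auto elim: terms.cases)

text \<open>In a root step every variable of \<open>r\<close> occurs in \<open>l\<close>, so what is
  substituted for it is already a subterm of the redex and hence a term over the alphabet.\<close>

lemma rstep_in_terms:
  assumes "trs_over \<Sigma> R" "(s, t) \<in> rstep R" "s \<in> terms \<Sigma>"
  shows "t \<in> terms \<Sigma>"
  using assms(2,3)
proof (induction rule: rstep.induct)
  case (root l r \<sigma>)
  then have "r \<in> terms \<Sigma>" "vars r \<subseteq> vars l"
    using assms(1) by (auto simp: trs_over_def)
  then show ?case
    using root by (intro subst_in_terms) (auto dest: subst_in_termsD)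
next
  case (arg s t f us vs)
  from arg.prems have "(f, length (us @ s # vs)) \<in> \<Sigma>" "\<forall>u\<in>set (us @ s # vs). u \<in> terms \<Sigma>"
    by (auto elim: terms.cases)
  with arg.IH show ?case
    by (intro terms.Fun) auto
qed

lemma rsteps_in_terms:
  assumes "(s, t) \<in> (rstep R)\<^sup>*" "trs_over \<Sigma> R" "s \<in> terms \<Sigma>"
  shows "t \<in> terms \<Sigma>"
  using assms by (induction rule: rtrancl_induct) (auto dest: rstep_in_terms)

lemma funs_in_alphabet: "t \<in> terms \<Sigma> \<Longrightarrow> funs t \<subseteq> fst ` \<Sigma>"
  by (induction rule: terms.induct) force+

lemma symbols_subset: "t \<in> terms \<Sigma> \<Longrightarrow> symbols t \<subseteq> \<Sigma>"
  by (induction rule: terms.induct) auto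

section \<open>Coding variables by two fresh symbols, and decoding\<close>

definition var_code :: "'f \<Rightarrow> 'f \<Rightarrow> nat \<Rightarrow> ('f, 'v) trm" where
  "var_code sc zr i = ((\<lambda>t. Fun sc [t]) ^^ i) (Fun zr [])"

text \<open>The symbol \<open>sc\<close> is undone by a shift of the variables. This also works for the terms
  \<open>sc t\<close> in which a rule with a variable as left-hand side has been applied below \<open>sc\<close>.\<close>

primrec decode_vars :: "'f \<Rightarrow> 'f \<Rightarrow> ('f, 'v) trm \<Rightarrow> ('f, nat) trm" where
  "decode_vars sc zr (Var x) = Var 0"
| "decode_vars sc zr (Fun f ts) =
    (if f = zr then Var 0
     else if f = sc then subst (\<lambda>i. Var (Suc i)) (hd (map (decode_vars sc zr) ts))
     else Fun f (map (decode_vars sc zr) ts))"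

text \<open>Away from the two fresh symbols, \<open>decode_vars\<close> only descends into the
  arguments, so it acts just on the terms substituted for the variables.\<close>

lemma decode_vars_subst:
  "funs t \<inter> {sc, zr} = {} \<Longrightarrow>
    decode_vars sc zr (subst \<sigma> t) = subst (\<lambda>x. decode_vars sc zr (\<sigma> x)) t"
proof (induction t)
  case (Fun f ts)
  then have "decode_vars sc zr (subst \<sigma> t) = subst (\<lambda>x. decode_vars sc zr (\<sigma> x)) t"
    if "t \<in> set ts" for t
    using that by fastforce
  moreover have "f \<noteq> sc" "f \<noteq> zr"
    using Fun.prems by auto
  ultimately show ?case
    by simp
qed simp

lemma decode_var_code: "sc \<noteq> zr \<Longrightarrow> decode_vars sc zr (var_code sc zr i) = Var i"
  by (induction i) (simp_all add: var_code_def)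

lemma decode_vars_subst_var_code:
  "sc \<noteq> zr \<Longrightarrow> funs t \<inter> {sc, zr} = {} \<Longrightarrow> decode_vars sc zr (subst (var_code sc zr) t) = t"
  by (simp add: decode_vars_subst decode_var_code subst_Var)

text \<open>A root step decodes to a root step with the decoded substitution. Below
  \<open>zr\<close>, or in a later argument of \<open>sc\<close>, a step disappears; in the first
  argument of \<open>sc\<close> it survives the shift of variables. Hence the conclusion allows zero
  steps.\<close>

lemma rstep_decode_vars:
  assumes "\<forall>(l, r)\<in>R. funs l \<inter> {sc, zr} = {} \<and> funs r \<inter> {sc, zr} = {}"
    and "(s, t) \<in> rstep R"
  shows "(decode_vars sc zr s, decode_vars sc zr t) \<in> (rstep R)\<^sup>*"
  using assms(2)
proof (induction rule: rstep.induct)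
  case (root l r \<sigma>)
  then show ?case
    using assms(1) by (auto simp add: decode_vars_subst rstep.root r_into_rtrancl)
next
  case (arg s t f us vs)
  then show ?case
    using rsteps_arg[OF arg.IH, of f "map (decode_vars sc zr) us" "map (decode_vars sc zr) vs"]
    by (cases us) (auto intro: rsteps_subst)
qed

lemma rsteps_decode_vars:
  assumes "\<forall>(l, r)\<in>R. funs l \<inter> {sc, zr} = {} \<and> funs r \<inter> {sc, zr} = {}"
    and "(s, t) \<in> (rstep R)\<^sup>*"
  shows "(decode_vars sc zr s, decode_vars sc zr t) \<in> (rstep R)\<^sup>*"
  using assms(2)
  by (induction rule: rtrancl_induct)
    (auto dest: rstep_decode_vars[OF assms(1)] intro: rtrancl_trans)

text \<open>One direction is closure of rewriting under substitution. For the other, a common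
  descendant of the coded terms is decoded; it need not itself be the code of a term, since
  \<open>decode_vars\<close> is total and inverts the coding on \<open>p\<close> and
  \<open>q\<close>.\<close>

lemma joinable_iff_var_code:
  assumes "\<forall>(l, r)\<in>R. funs l \<inter> {sc, zr} = {} \<and> funs r \<inter> {sc, zr} = {}"
    and "sc \<noteq> zr" "funs p \<inter> {sc, zr} = {}" "funs q \<inter> {sc, zr} = {}"
  shows "(\<exists>r. (p, r) \<in> (rstep R)\<^sup>* \<and> (q, r) \<in> (rstep R)\<^sup>*) \<longleftrightarrow>
    (\<exists>r. (subst (var_code sc zr) p, r) \<in> (rstep R)\<^sup>* \<and>
      (subst (var_code sc zr) q, r) \<in> (rstep R)\<^sup>*)" (is "_ \<longleftrightarrow> ?coded")
proof
  assume ?coded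
  then obtain r where "(subst (var_code sc zr) p, r) \<in> (rstep R)\<^sup>*"
    "(subst (var_code sc zr) q, r) \<in> (rstep R)\<^sup>*"
    by blast
  from this[THEN rsteps_decode_vars[OF assms(1)]]
  show "\<exists>r. (p, r) \<in> (rstep R)\<^sup>* \<and> (q, r) \<in> (rstep R)\<^sup>*"
    using assms by (auto simp: decode_vars_subst_var_code)
qed (blast dest: rsteps_subst)

lemma computable_var_code: "computable (\<lambda>i. enc_trm (var_code sc zr i))"
proof -
  \<comment> \<open>The step function takes the code \<open>y\<close> of a term \<open>t\<close> to
    the code of \<open>Fun sc [t]\<close>; \<open>Suc (prod_encode (y, 0))\<close> codes the
    one-element argument list.\<close>
  have *: "enc_trm (var_code sc zr i) = rec_nat (enc_trm (Fun zr []))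
      (\<lambda>k y. Suc (2 * prod_encode (sc, Suc (prod_encode (y, 0))))) i" for i
    by (induction i) (simp_all add: var_code_def sum_encode_def)
  show ?thesis
    unfolding * by (intro computable_rec_nat computable_intros)
qed

lemma ground_var_code:
  assumes "(zr, 0) \<in> \<Sigma>" "(sc, 1) \<in> \<Sigma>"
  shows "var_code sc zr i \<in> ground_terms \<Sigma>"
  by (induction i) (use assms in \<open>auto simp: var_code_def ground_terms_def intro!: terms.Fun\<close>)

lemma subst_in_ground_terms:
  assumes "t \<in> terms \<Sigma>" "\<And>x. \<sigma> x \<in> ground_terms \<Sigma>"
  shows "subst \<sigma> t \<in> ground_terms \<Sigma>"
proof -
  have "vars (subst \<sigma> t) = {}"
    using assms(2) by (induction t) (auto simp: ground_terms_def)
  then show ?thesis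
    using assms by (simp add: ground_terms_def subst_in_terms)
qed

lemma terms_mono: "t \<in> terms \<Sigma> \<Longrightarrow> \<Sigma> \<subseteq> \<Sigma>' \<Longrightarrow> t \<in> terms \<Sigma>'"
  by (induction rule: terms.induct) (auto intro!: terms.intros)


section \<open>Disjointness of languages of tree automata\<close>

text \<open>Evaluation by structure of the term replaces rewriting, so that inductions follow the
  term. The rule \<open>state\<close> also gives values to intermediate terms of a derivation, in
  which states already occur.\<close>

inductive run :: "bta \<Rightarrow> (nat + nat, 'v) trm \<Rightarrow> nat \<Rightarrow> bool" for C where
  state: "run C (state_const a) a"
| trans: "(d, as, a) \<in> transitions C \<Longrightarrow> list_all2 (run C) us as \<Longrightarrow> run C (Fun (Inl d) us) a"
| eps: "run C u a \<Longrightarrow> (a, a') \<in> epsilons C \<Longrightarrow> run C u a'"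

lemma state_const_eq_iff [simp]: "state_const a = state_const b \<longleftrightarrow> a = b"
  by (simp add: state_const_def)

lemma subst_state_const [simp]: "subst \<sigma> (state_const a) = state_const a"
  by (simp add: state_const_def)

lemma run_state_const_map:
  "list_all2 (run C) (map state_const as) as"
  by (simp add: list_all2_conv_all_nth run.state)

text \<open>Evaluation is preserved backwards along a step: the redex evaluates to the state
  constant that replaces it, and the rest of the run is kept.\<close>

lemma rstep_run:
  fixes s t :: "(nat + nat, 'v) trm"
  assumes "(s, t) \<in> rstep (bta_rules C)" "run C t a"
  shows "run C s a"
  using assms
proof (induction arbitrary: a rule: rstep.induct)
  case (root l r \<sigma>)
  have [simp]: "subst \<sigma> \<circ> state_const = state_const"
    by auto
  from root(1) consider d as b where "l = Fun (Inl d) (map state_const as)" "r = state_const b"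
      "(d, as, b) \<in> transitions C"
    | b b' where "l = state_const b" "r = state_const b'" "(b, b') \<in> epsilons C"
    unfolding bta_rules_def by blast
  then have "run C (subst \<sigma> l) b" if "r = state_const b" for b
    using that by cases (auto intro: run.intros run_state_const_map)
  moreover obtain b where "r = state_const b"
    using root(1) unfolding bta_rules_def by blast
  moreover from this root(2) have "run C (state_const b :: (nat + nat, 'v) trm) a"
    by simp
  \<comment> \<open>A run on a state constant consists of epsilon rules only, and these can be
    appended to any run that ends in this state.\<close>
  moreover have "run C s a"
    if "run C (state_const b :: (nat + nat, 'v) trm) a" "run C s b" for s :: "(nat + nat, 'v) trm"
    using that
    by (induction "state_const b :: (nat + nat, 'v) trm" a)
      (auto simp: state_const_def intro: run.eps)
  ultimately show ?case
    by blast
next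
  case (arg s t f us vs)
  from arg.prems show ?case
  proof (induction "Fun f (us @ t # vs)" a)
    case (trans d as a)
    then have "list_all2 (run C) (us @ t # vs) as"
      by (auto elim: list_all2_mono)
    then obtain xs b ys where "as = xs @ b # ys" "list_all2 (run C) us xs" "run C t b"
      "list_all2 (run C) vs ys"
      by (auto simp: list_all2_append1 list_all2_Cons1)
    then have "list_all2 (run C) (us @ s # vs) as"
      using arg.IH by (simp add: list_all2_appendI)
    with trans show ?case
      by (auto intro: run.trans)
  qed (auto simp: state_const_def intro: run.eps)
qed

lemma run_iff:
  fixes u :: "(nat + nat, 'v) trm"
  shows "run C u a \<longleftrightarrow> (u, state_const a) \<in> (rstep (bta_rules C))\<^sup>*"
proof
  assume "run C u a"
  then show "(u, state_const a) \<in> (rstep (bta_rules C))\<^sup>*"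
  proof induction
    case (trans d as a us)
    \<comment> \<open>Arguments are evaluated from left to right. The prefix \<open>xs\<close> is
      kept arbitrary because it gains one state constant per argument.\<close>
    have "(Fun (Inl d) (xs @ us), Fun (Inl d) (xs @ map state_const as))
        \<in> (rstep (bta_rules C))\<^sup>*" for xs
      using trans(2)
    proof (induction arbitrary: xs rule: list_all2_induct)
      case (Cons u us a as)
      from Cons(1) have "(Fun (Inl d) (xs @ u # us), Fun (Inl d) (xs @ state_const a # us))
          \<in> (rstep (bta_rules C))\<^sup>*"
        by (intro rsteps_arg) blast
      with Cons(3)[of "xs @ [state_const a]"] show ?case
        by (simp add: rtrancl_trans)
    qed simp
    from this[of "[]"]
    have "(Fun (Inl d) us, Fun (Inl d) (map state_const as)) \<in> (rstep (bta_rules C))\<^sup>*"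
      by simp
    moreover have "(Fun (Inl d) (map state_const as), state_const a) \<in> bta_rules C"
      using trans(1) by (auto simp: bta_rules_def)
    from rstep.root[OF this, of Var]
    have "(Fun (Inl d) (map state_const as), state_const a) \<in> rstep (bta_rules C)"
      by (simp add: subst_Var del: subst.simps)
    ultimately show ?case
      by (rule rtrancl_into_rtrancl)
  next
    case (eps u a a')
    have "(state_const a, state_const a') \<in> (bta_rules C :: (nat + nat, 'v) rules)"
      using eps(2) by (auto simp: bta_rules_def)
    from rstep.root[OF this, of Var] eps(3) show ?case
      by (simp add: subst_Var rtrancl_into_rtrancl)
  qed simp
next
  assume "(u, state_const a) \<in> (rstep (bta_rules C))\<^sup>*"
  then show "run C u a"
    by (induction rule: converse_rtrancl_induct) (auto intro: run.state rstep_run)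
qed

section \<open>Evaluation of terms without states, and pairs of states reached by a common
  term\<close>

definition reaches :: "bta \<Rightarrow> (nat, 'v) trm \<Rightarrow> nat \<Rightarrow> bool" where
  "reaches C t a \<longleftrightarrow> run C (map_trm Inl id t) a"

lemma bta_lang_iff: "t \<in> bta_lang \<Sigma> C \<longleftrightarrow> t \<in> ground_terms \<Sigma> \<and> (\<exists>a\<in>finals C. reaches C t a)"
  by (simp add: bta_lang_def reaches_def run_iff)

lemma reaches_trans:
  "(d, as, a) \<in> transitions C \<Longrightarrow> list_all2 (reaches C) ts as \<Longrightarrow> reaches C (Fun d ts) a"
  by (auto simp: reaches_def list_all2_conv_all_nth intro!: run.trans)

lemma reaches_eps: "reaches C t a \<Longrightarrow> (a, a') \<in> epsilons C \<Longrightarrow> reaches C t a'"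
  unfolding reaches_def by (rule run.eps)

text \<open>A relabelled term over the alphabet contains no state constant, so the case
  \<open>state\<close> of \<open>run\<close> cannot arise.\<close>

lemma reaches_induct [consumes 1, case_names trans eps]:
  fixes t :: "(nat, 'v) trm"
  assumes "reaches C t a"
    and "\<And>d as a ts. (d, as, a) \<in> transitions C \<Longrightarrow>
      list_all2 (\<lambda>t a. reaches C t a \<and> P t a) ts as \<Longrightarrow> P (Fun d ts) a"
    and "\<And>t a a'. reaches C t a \<Longrightarrow> P t a \<Longrightarrow> (a, a') \<in> epsilons C \<Longrightarrow> P t a'"
  shows "P t a"
  using assms(1) unfolding reaches_def
proof (induction "map_trm Inl id t :: (nat + nat, 'v) trm" a arbitrary: t)
  case (state a)
  then show ?case
    by (cases t) (auto simp: state_const_def)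
next
  case (trans d as a us)
  then obtain ts where "t = Fun d ts" "us = map (map_trm Inl id) ts"
    by (cases t) auto
  with trans show ?case
    by (auto simp: reaches_def list_all2_conv_all_nth intro!: assms(2))
next
  case (eps a a')
  then show ?case
    by (auto simp: reaches_def intro: assms(3))
qed

lemma reaches_states:
  assumes "bta_over \<Sigma> C" "reaches C t a"
  shows "a \<in> states C"
  using assms(2) by (induction rule: reaches_induct) (use assms(1) in \<open>auto simp: bta_over_def\<close>)

lemma reaches_ground_terms:
  assumes "bta_over \<Sigma> C" "reaches C t a"
  shows "t \<in> ground_terms \<Sigma>"
  using assms(2)
proof (induction rule: reaches_induct)
  case (trans d as a ts)
  then have "(d, length ts) \<in> \<Sigma>"
    using assms(1) by (auto simp: bta_over_def list_all2_lengthD)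
  then show ?case
    using trans(2)
    by (auto simp: ground_terms_def list_all2_conv_all_nth in_set_conv_nth intro!: terms.Fun)
qed

text \<open>Epsilon rules move one component at a time. Constants start the closure: for empty
  argument lists \<open>list_all2\<close> holds trivially, so their target pairs are forced into
  \<open>S\<close>.\<close>

definition product_closed :: "bta \<Rightarrow> bta \<Rightarrow> (nat \<times> nat) set \<Rightarrow> bool" where
  "product_closed C D S \<longleftrightarrow>
     (\<forall>(a, a')\<in>epsilons C. \<forall>b. (a, b) \<in> S \<longrightarrow> (a', b) \<in> S) \<and>
     (\<forall>(b, b')\<in>epsilons D. \<forall>a. (a, b) \<in> S \<longrightarrow> (a, b') \<in> S) \<and>
     (\<forall>(d, as, a)\<in>transitions C. \<forall>(e, bs, b)\<in>transitions D.
        d = e \<and> list_all2 (\<lambda>a b. (a, b) \<in> S) as bs \<longrightarrow> (a, b) \<in> S)"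

text \<open>The two runs on \<open>t\<close> may use epsilon rules at different moments. The outer
  induction follows the run of \<open>C\<close>; once it arrives at a proper transition, an inner
  induction follows the run of \<open>D\<close> on the same term.\<close>

lemma product_closed_reaches:
  assumes S: "product_closed C D S" and "reaches C t a" "reaches D t b"
  shows "(a, b) \<in> S"
  using assms(2,3)
proof (induction arbitrary: b rule: reaches_induct)
  case (trans d as a ts)
  show ?case
    using trans(3)
  proof (induction "Fun d ts" b rule: reaches_induct)
    case (trans bs b)
    have "list_all2 (\<lambda>a b. (a, b) \<in> S) as bs"
      using trans(2) \<open>list_all2 _ ts as\<close> by (auto simp: list_all2_conv_all_nth)
    then show ?case
      using S trans(1) \<open>(d, as, a) \<in> transitions C\<close> unfolding product_closed_def by fast
  next
    case (eps b b')
    then show ?case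
      using S unfolding product_closed_def by fast
  qed
next
  case (eps t a a')
  then show ?case
    using S unfolding product_closed_def by fast
qed

text \<open>For a pair of transitions with the same symbol, a common term is chosen for each
  argument position; the symbol applied to these terms witnesses the target pair.\<close>

lemma product_closed_reachable_pairs:
  "product_closed C D {(a, b). \<exists>t :: (nat, 'v) trm. reaches C t a \<and> reaches D t b}"
proof -
  have step: "\<exists>t :: (nat, 'v) trm. reaches C t a \<and> reaches D t b"
    if trans: "(d, as, a) \<in> transitions C" "(d, bs, b) \<in> transitions D"
      and all: "list_all2 (\<lambda>a b. \<exists>t :: (nat, 'v) trm. reaches C t a \<and> reaches D t b) as bs"
    for d as a bs b
  proof -
    obtain f :: "nat \<Rightarrow> (nat, 'v) trm" where
      f: "\<And>i. i < length as \<Longrightarrow> reaches C (f i) (as ! i) \<and> reaches D (f i) (bs ! i)"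
      using all unfolding list_all2_conv_all_nth by metis
    have "length as = length bs"
      using all by (rule list_all2_lengthD)
    with f have "list_all2 (reaches C) (map f [0..<length as]) as"
      "list_all2 (reaches D) (map f [0..<length as]) bs"
      by (simp_all add: list_all2_conv_all_nth)
    with trans show ?thesis
      by (blast intro: reaches_trans)
  qed
  show ?thesis
    unfolding product_closed_def mem_Collect_eq prod.case
    by (intro conjI ballI; clarify; blast intro: reaches_eps step)
qed

definition separates :: "bta \<Rightarrow> bta \<Rightarrow> (nat \<times> nat) set \<Rightarrow> bool" where
  "separates C D S \<longleftrightarrow> product_closed C D S \<and> S \<inter> finals C \<times> finals D = {}"

lemma separates_disjoint: "separates C D S \<Longrightarrow> bta_lang \<Sigma> C \<inter> bta_lang \<Sigma> D = {}"
  unfolding separates_def disjoint_iff bta_lang_iff using product_closed_reaches by blast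

text \<open>The pairs reached by a common term form a separating set. Its inclusion in
  \<open>states C \<times> states D\<close> is what makes the later search finite.\<close>

lemma disjoint_separates:
  assumes "bta_over \<Sigma> C" "bta_over \<Sigma> D"
    and "bta_lang \<Sigma> C \<inter> bta_lang \<Sigma> D = ({} :: (nat, 'v) trm set)"
  shows "\<exists>S \<subseteq> states C \<times> states D. separates C D S"
proof (intro exI conjI)
  let ?S = "{(a, b). \<exists>t :: (nat, 'v) trm. reaches C t a \<and> reaches D t b}"
  show "?S \<subseteq> states C \<times> states D"
    using assms(1,2) by (auto dest: reaches_states)
  have "?S \<inter> finals C \<times> finals D = {}"
    using assms by (auto simp: bta_lang_iff disjoint_iff dest: reaches_ground_terms)
  then show "separates C D ?S"
    unfolding separates_def using product_closed_reachable_pairs by blast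
qed


section \<open>Disjointness on codes of tree automata\<close>

text \<open>Since \<open>x < 2 ^ x\<close>, a code exceeds all elements of the set it codes.
  Quantifiers over coded sets thereby become bounded quantifiers, which preserve
  decidability.\<close>

lemma in_set_decode_less: "x \<in> set_decode n \<Longrightarrow> x < n"
proof (rule ccontr)
  assume "x \<in> set_decode n" "\<not> x < n"
  then have "n < 2 ^ x"
    using less_exp[of x] by linarith
  with \<open>x \<in> set_decode n\<close> show False
    by (simp add: set_decode_def)
qed

lemma all_set_decode: "(\<forall>x<n. x \<in> set_decode n \<longrightarrow> P x) \<longleftrightarrow> (\<forall>x\<in>set_decode n. P x)"
  using in_set_decode_less by blast

lemma set_encode_less:
  assumes "A \<subseteq> {..<n}" shows "set_encode A < 2 ^ n"
proof -
  have "set_encode A \<le> (\<Sum>i<n. 2 ^ i)"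
    unfolding set_encode_def by (rule sum_mono2) (use assms in auto)
  also have "\<dots> < 2 ^ n"
    by (induction n) auto
  finally show ?thesis .
qed

definition pairs_of :: "nat \<Rightarrow> (nat \<times> nat) set" where
  "pairs_of s = {p. prod_encode p \<in> set_decode s}"

lemma ball_set_decode_pairs: "(\<forall>p\<in>set_decode s. P (pfst p) (psnd p)) \<longleftrightarrow> (\<forall>(a, b)\<in>pairs_of s. P a b)"
proof -
  have "set_decode s = prod_encode ` pairs_of s"
  proof (intro equalityI subsetI)
    fix x assume "x \<in> set_decode s"
    then have "(pfst x, psnd x) \<in> pairs_of s"
      by (simp add: pairs_of_def)
    then show "x \<in> prod_encode ` pairs_of s"
      by (rule rev_image_eqI) simp
  qed (auto simp: pairs_of_def)
  then show ?thesis
    by (auto simp: split_beta)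
qed

text \<open>A list is no longer than its code, so \<open>l + m\<close> bounds all relevant
  positions. The code 0 marks the end of a list; requiring both lists to end together forces equal
  lengths.\<close>

definition coded_list_all2 :: "nat \<Rightarrow> nat \<Rightarrow> nat \<Rightarrow> bool" where
  "coded_list_all2 s l m \<longleftrightarrow> (\<forall>i<l + m.
     (ldrop i l = 0 \<longleftrightarrow> ldrop i m = 0) \<and>
     (ldrop i l \<noteq> 0 \<longrightarrow> prod_encode (lhd (ldrop i l), lhd (ldrop i m)) \<in> set_decode s))"

lemma coded_list_all2_list_encode:
  "coded_list_all2 s (list_encode as) (list_encode bs) \<longleftrightarrow>
    list_all2 (\<lambda>a b. (a, b) \<in> pairs_of s) as bs"
proof
  assume *: "coded_list_all2 s (list_encode as) (list_encode bs)"
  have "i < length as \<longleftrightarrow> i < length bs" for i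
  proof (cases "i < list_encode as + list_encode bs")
    case True
    with * show ?thesis
      by (auto simp: coded_list_all2_def simp flip: not_le)
  next
    case False
    then show ?thesis
      using length_le_list_encode[of as] length_le_list_encode[of bs] by linarith
  qed
  then have "length as = length bs"
    by (metis less_irrefl nat_neq_iff)
  moreover have "(as ! i, bs ! i) \<in> pairs_of s" if "i < length as" for i
  proof -
    have "i < list_encode as + list_encode bs"
      using that length_le_list_encode[of as] by linarith
    with * that calculation show ?thesis
      by (auto simp: coded_list_all2_def pairs_of_def)
  qed
  ultimately show "list_all2 (\<lambda>a b. (a, b) \<in> pairs_of s) as bs"
    by (simp add: list_all2_conv_all_nth)
next
  assume "list_all2 (\<lambda>a b. (a, b) \<in> pairs_of s) as bs"
  then show "coded_list_all2 s (list_encode as) (list_encode bs)"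
    by (auto simp: coded_list_all2_def list_all2_conv_all_nth pairs_of_def)
qed

lemma decidable_coded_list_all2 [computable_intros]:
  assumes "computable a" "computable b" "computable c"
  shows "decidable (\<lambda>x. coded_list_all2 (a x) (b x) (c x))"
proof -
  have "decidable (\<lambda>z. coded_list_all2 (pfst z) (pfst (psnd z)) (psnd (psnd z)))"
    unfolding coded_list_all2_def by (intro computable_intros)
  from decidable_comp[OF this, of "\<lambda>x. prod_encode (a x, prod_encode (b x, c x))"] show ?thesis
    using assms by (simp add: computable_intros)
qed

text \<open>Positions 1, 2 and 3 of a coded automaton hold the final states, the transitions and the
  epsilon rules. Each quantifier over a coded set is bounded by the code of that set, in the form
  that \<open>decidable_all_less\<close> handles.\<close>

definition coded_separates :: "nat \<Rightarrow> nat \<Rightarrow> nat \<Rightarrow> bool" where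
  "coded_separates s c d \<longleftrightarrow>
     (\<forall>e<lhd (ldrop 3 c). e \<in> set_decode (lhd (ldrop 3 c)) \<longrightarrow>
       (\<forall>p<s. p \<in> set_decode s \<longrightarrow> pfst p = pfst e \<longrightarrow>
         prod_encode (psnd e, psnd p) \<in> set_decode s)) \<and>
     (\<forall>e<lhd (ldrop 3 d). e \<in> set_decode (lhd (ldrop 3 d)) \<longrightarrow>
       (\<forall>p<s. p \<in> set_decode s \<longrightarrow> psnd p = pfst e \<longrightarrow>
         prod_encode (pfst p, psnd e) \<in> set_decode s)) \<and>
     (\<forall>t<lhd (ldrop 2 c). t \<in> set_decode (lhd (ldrop 2 c)) \<longrightarrow>
       (\<forall>u<lhd (ldrop 2 d). u \<in> set_decode (lhd (ldrop 2 d)) \<longrightarrow>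
         pfst t = pfst u \<and> coded_list_all2 s (pfst (psnd t)) (pfst (psnd u)) \<longrightarrow>
         prod_encode (psnd (psnd t), psnd (psnd u)) \<in> set_decode s)) \<and>
     (\<forall>p<s. p \<in> set_decode s \<longrightarrow>
       \<not> (pfst p \<in> set_decode (lhd (ldrop 1 c)) \<and> psnd p \<in> set_decode (lhd (ldrop 1 d))))"

lemma coded_separates_enc_bta:
  assumes "bta_over \<Sigma> C" "bta_over \<Sigma>' D"
  shows "coded_separates s (enc_bta C) (enc_bta D) \<longleftrightarrow> separates C D (pairs_of s)"
proof -
  have dec: "set_decode (lhd (ldrop 1 (enc_bta B))) = finals B"
    "set_decode (lhd (ldrop 2 (enc_bta B))) = enc_transition ` transitions B"
    "set_decode (lhd (ldrop 3 (enc_bta B))) = prod_encode ` epsilons B" if "bta_over A B" for A B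
  proof -
    have "finite (finals B)" "finite (transitions B)" "finite (epsilons B)"
      using that unfolding bta_over_def
      by (auto intro: finite_subset[of _ "states B"] finite_subset[of _ "states B \<times> states B"])
    then show "set_decode (lhd (ldrop 1 (enc_bta B))) = finals B"
      "set_decode (lhd (ldrop 2 (enc_bta B))) = enc_transition ` transitions B"
      "set_decode (lhd (ldrop 3 (enc_bta B))) = prod_encode ` epsilons B"
      by (simp_all add: enc_bta_def del: list_encode.simps)
  qed
  show ?thesis
    \<comment> \<open>The quantifiers over the candidate set become quantifiers over pairs,
      separately for the clause on final states and for the epsilon clauses of \<open>C\<close> and
      \<open>D\<close>.\<close>
    unfolding coded_separates_def all_set_decode
    unfolding dec[OF assms(1)] dec[OF assms(2)]
      ball_set_decode_pairs[of s "\<lambda>a b. \<not> (a \<in> _ \<and> b \<in> _)"]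
      ball_set_decode_pairs[of s "\<lambda>a b. a = _ \<longrightarrow> prod_encode (_, b) \<in> _"]
      ball_set_decode_pairs[of s "\<lambda>a b. b = _ \<longrightarrow> prod_encode (a, _) \<in> _"]
    by (auto simp: separates_def product_closed_def enc_transition_def coded_list_all2_list_encode
      split_beta pairs_of_def)
qed

text \<open>Position 0 holds the set of states, whose code exceeds every state. By monotonicity of
  pairing, each pair of states has a code below the exponent, and a set of numbers below
  \<open>n\<close> has a code below \<open>2 ^ n\<close>; so all candidates are covered.\<close>

definition coded_overlap :: "nat \<Rightarrow> nat \<Rightarrow> bool" where
  "coded_overlap c d \<longleftrightarrow>
     (\<forall>s<2 ^ Suc (prod_encode (lhd (ldrop 0 c), lhd (ldrop 0 d))). \<not> coded_separates s c d)"

lemma decidable_coded_overlap [computable_intros]: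
  assumes "computable a" "computable b"
  shows "decidable (\<lambda>x. coded_overlap (a x) (b x))"
proof -
  have "decidable (\<lambda>z. coded_overlap (pfst z) (psnd z))"
    unfolding coded_overlap_def coded_separates_def by (intro computable_intros)
  from decidable_comp[OF this, of "\<lambda>x. prod_encode (a x, b x)"] show ?thesis
    using assms by (simp add: computable_intros)
qed

lemma coded_overlap_enc_bta:
  assumes "bta_over \<Sigma> C" "bta_over \<Sigma> D"
  shows "coded_overlap (enc_bta C) (enc_bta D) \<longleftrightarrow>
    bta_lang \<Sigma> C \<inter> bta_lang \<Sigma> D \<noteq> ({} :: (nat, 'v) trm set)"
proof -
  let ?b = "\<lambda>B. set_encode (states B)"
  have b: "lhd (ldrop 0 (enc_bta B)) = ?b B" for B
    by (simp add: enc_bta_def del: list_encode.simps)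
  have "\<exists>s<2 ^ Suc (prod_encode (?b C, ?b D)). separates C D (pairs_of s)"
    if disjoint: "bta_lang \<Sigma> C \<inter> bta_lang \<Sigma> D = ({} :: (nat, 'v) trm set)"
  proof -
    obtain S where S: "S \<subseteq> states C \<times> states D" "separates C D S"
      using disjoint_separates[OF assms disjoint] by blast
    have fin: "finite (states C)" "finite (states D)"
      using assms by (simp_all add: bta_over_def)
    have "prod_encode (a, b) < Suc (prod_encode (?b C, ?b D))" if "(a, b) \<in> S" for a b
    proof -
      have "a < ?b C" "b < ?b D"
        using that S(1) fin in_set_decode_less[of a "?b C"] in_set_decode_less[of b "?b D"]
        by auto
      then show ?thesis
        using prod_encode_mono[of a "?b C" b "?b D"] by simp
    qed
    then have "set_encode (prod_encode ` S) < 2 ^ Suc (prod_encode (?b C, ?b D))"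
      by (intro set_encode_less) auto
    moreover have "pairs_of (set_encode (prod_encode ` S)) = S"
      using finite_subset[OF S(1)] fin
      by (auto simp: pairs_of_def inj_image_mem_iff[OF inj_prod_encode])
    ultimately show ?thesis
      using S(2) by metis
  qed
  then show ?thesis
    unfolding coded_overlap_def coded_separates_enc_bta[OF assms] b
    using separates_disjoint by metis
qed


section \<open>Joinability\<close>

theorem mainTheorem3:
  fixes \<Sigma> :: "nat ranked" and R :: "(nat, nat) rules"
  assumes "ranked_alphabet \<Sigma>"
    and "trs_over \<Sigma> R"
    and "eprf R"
  shows "decidable_on (terms \<Sigma> \<times> terms \<Sigma>) enc_trm_pair
    (\<lambda>(p, q). \<exists>r\<in>terms \<Sigma>. (p, r) \<in> (rstep R)\<^sup>* \<and> (q, r) \<in> (rstep R)\<^sup>*)"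
proof -
  have fin: "finite (fst ` \<Sigma>)"
    using assms(1) by (simp add: ranked_alphabet_def)
  obtain zr where zr: "zr \<notin> fst ` \<Sigma>"
    using ex_new_if_finite[OF infinite_UNIV_nat fin] by blast
  obtain sc where sc: "sc \<notin> insert zr (fst ` \<Sigma>)"
    using ex_new_if_finite[OF infinite_UNIV_nat, of "insert zr (fst ` \<Sigma>)"] fin by blast
  define \<Sigma>' where "\<Sigma>' = insert (sc, 1) (insert (zr, 0) \<Sigma>)"
  define \<tau> :: "nat \<Rightarrow> (nat, nat) trm" where "\<tau> = var_code sc zr"
  have "(sc, n) \<notin> \<Sigma>" "(zr, n) \<notin> \<Sigma>" for n
    using sc zr by force+
  then have alphabet: "ranked_alphabet \<Sigma>'"
    using assms(1) sc by (auto simp: ranked_alphabet_def \<Sigma>'_def single_valued_def)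
  have "sign R \<subseteq> \<Sigma>"
    using assms(2) symbols_subset by (fastforce simp: sign_def trs_over_def)
  then have sign: "sign R \<subseteq> \<Sigma>'"
    by (auto simp: \<Sigma>'_def)
  have fresh: "funs t \<inter> {sc, zr} = {}" if "t \<in> terms \<Sigma>" for t :: "(nat, nat) trm"
    using funs_in_alphabet[OF that] sc zr by blast
  have fresh_rules: "\<forall>(l, r)\<in>R. funs l \<inter> {sc, zr} = {} \<and> funs r \<inter> {sc, zr} = {}"
    using assms(2) by (auto simp: trs_over_def dest!: fresh)
  have ground: "subst \<tau> t \<in> ground_terms \<Sigma>'" if "t \<in> terms \<Sigma>" for t :: "(nat, nat) trm"
  proof (rule subst_in_ground_terms)
    show "t \<in> terms \<Sigma>'"
      using that by (rule terms_mono) (auto simp: \<Sigma>'_def)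
    show "\<tau> x \<in> ground_terms \<Sigma>'" for x
      unfolding \<tau>_def by (rule ground_var_code) (simp_all add: \<Sigma>'_def)
  qed
  obtain g where "computable g" and g: "\<And>t. g (enc_trm t) = enc_trm (subst \<tau> t)"
    using computable_subst[OF computable_var_code[of sc zr]] unfolding \<tau>_def by blast
  from assms(3) obtain F where "computable F"
    and F: "\<forall>\<Sigma> L. ranked_alphabet \<Sigma> \<and> sign R \<subseteq> \<Sigma> \<and> finite L \<and> L \<subseteq> ground_terms \<Sigma> \<longrightarrow>
      (\<exists>C. bta_over \<Sigma> C \<and> F (prod_encode (enc_alphabet \<Sigma>, enc_trm_set L)) = enc_bta C \<and>
        bta_lang \<Sigma> C = descendants R L)"
    unfolding eprf_def by (elim exE conjE)
  \<comment> \<open>\<open>2 ^ n\<close> is the code of the singleton set of \<open>n\<close>, so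
    \<open>G\<close> passes to \<open>F\<close> the language consisting of the coded term alone. The
    extended alphabet enters as a constant.\<close>
  define G where "G x = F (prod_encode (enc_alphabet \<Sigma>', 2 ^ g x))" for x
  have G: "\<exists>C. bta_over \<Sigma>' C \<and> G (enc_trm t) = enc_bta C \<and>
      bta_lang \<Sigma>' C = descendants R {subst \<tau> t}" if "t \<in> terms \<Sigma>" for t
    using F[rule_format, of \<Sigma>' "{subst \<tau> t}"] alphabet sign ground[OF that]
    by (simp add: G_def g enc_trm_set_def set_encode_def)
  have "computable G"
    unfolding G_def by (intro computable_comp[OF \<open>computable F\<close>] computable_intros \<open>computable g\<close>)
  then have *: "computable (\<lambda>x. of_bool (coded_overlap (G (pfst x)) (G (psnd x))))"
    unfolding decidable_def[symmetric]
    by (intro computable_intros computable_comp[OF \<open>computable G\<close>])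
  have **: "coded_overlap (G (enc_trm p)) (G (enc_trm q)) \<longleftrightarrow>
      (\<exists>r\<in>terms \<Sigma>. (p, r) \<in> (rstep R)\<^sup>* \<and> (q, r) \<in> (rstep R)\<^sup>*)"
    if pq: "p \<in> terms \<Sigma>" "q \<in> terms \<Sigma>" for p q
  proof -
    obtain C D where "bta_over \<Sigma>' C" "G (enc_trm p) = enc_bta C"
        "bta_lang \<Sigma>' C = descendants R {subst \<tau> p}"
      and "bta_over \<Sigma>' D" "G (enc_trm q) = enc_bta D"
        "bta_lang \<Sigma>' D = descendants R {subst \<tau> q}"
      using pq[THEN G] by blast
    then have "coded_overlap (G (enc_trm p)) (G (enc_trm q)) \<longleftrightarrow>
        descendants R {subst \<tau> p} \<inter> descendants R {subst \<tau> q} \<noteq> {}"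
      using coded_overlap_enc_bta[of \<Sigma>' C D, where 'v = nat] by simp
    also have "\<dots> \<longleftrightarrow> (\<exists>r. (subst \<tau> p, r) \<in> (rstep R)\<^sup>* \<and> (subst \<tau> q, r) \<in> (rstep R)\<^sup>*)"
      by (auto simp: descendants_def)
    also have "\<dots> \<longleftrightarrow> (\<exists>r. (p, r) \<in> (rstep R)\<^sup>* \<and> (q, r) \<in> (rstep R)\<^sup>*)"
      unfolding \<tau>_def using sc pq fresh
      by (intro joinable_iff_var_code[symmetric] fresh_rules) auto
    \<comment> \<open>Every descendant of \<open>p\<close> is again a term over
      \<open>\<Sigma>\<close>, so restricting \<open>r\<close> loses nothing.\<close>
    also have "\<dots> \<longleftrightarrow> (\<exists>r\<in>terms \<Sigma>. (p, r) \<in> (rstep R)\<^sup>* \<and> (q, r) \<in> (rstep R)\<^sup>*)"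
      using rsteps_in_terms[OF _ assms(2) pq(1)] by blast
    finally show ?thesis .
  qed
  show ?thesis
    unfolding decidable_on_def
    by (rule exI, rule conjI, rule *) (auto simp: enc_trm_pair_def **)
qed

end
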